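(* Let $G$ be a finite abelian group, $k\ge1$, $\Gamma=G\wr\mathbb{Z}^k=\Sigma\rtimes_\alpha\mathbb{Z}^k$, and $\varphi$ an automorphism of $\Gamma$ with restriction $\varphi'=\varphi|_\Sigma$ and induced automorphism $\overline{\varphi}$ of $\Gamma/\Sigma\cong\mathbb{Z}^k$. Let $\varphi_1:\Gamma\to\Gamma$ be defined by $\varphi_1(hm)=\varphi'(h)\overline{\varphi}(m)$ for $h\in\Sigma$, $m\in\mathbb{Z}^k$. Then $\varphi_1$ is an automorphism of $\Gamma$ and $R(\varphi)=R(\varphi_1)$.
   Context: Reidemeister number $R(\psi)$: number of classes of the relation $x\sim gx\psi(g^{-1})$, $g\in\Gamma$ (possibly $\infty$). $\Sigma=\bigoplus_{x\in\mathbb{Z}^k}G_x$, $G_x\cong G$, $\alpha(x)(g_y)=g_{x+y}$; $\Sigma$ is the torsion subset of $\Gamma$ and hence $\varphi$-invariant. *)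

theory Defs
  imports "HOL-Algebra.Algebra" "HOL-Library.Extended_Nat"
begin

text \<open>Z^k is represented as 'n => int with 'n a finite type, k = CARD('n) >= 1.
  The wreath product G wr Z^k = Sigma x|_alpha Z^k: elements are pairs (h, m) where
  h : Z^k -> carrier G is finitely supported (an element of the direct sum Sigma)
  and m in Z^k. The action alpha(x)(g_y) = g_(x+y) is the shift
  (alpha(m) h)(z) = h(z - m), so (h1,m1)(h2,m2) = (h1 * alpha(m1) h2, m1 + m2).\<close>

definition wreath_Zk :: "('g, 'b) monoid_scheme \<Rightarrow>
    (((('n::finite) \<Rightarrow> int) \<Rightarrow> 'g) \<times> ('n \<Rightarrow> int)) monoid" where
  "wreath_Zk G = \<lparr> carrier = {(h, m). (\<forall>z. h z \<in> carrier G) \<and> finite {z. h z \<noteq> \<one>\<^bsub>G\<^esub>}},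
     monoid.mult = (\<lambda>x y. (\<lambda>z. fst x z \<otimes>\<^bsub>G\<^esub> fst y (\<lambda>i. z i - snd x i), \<lambda>i. snd x i + snd y i)),
     one = (\<lambda>_. \<one>\<^bsub>G\<^esub>, \<lambda>_. 0) \<rparr>"

text \<open>The element h m of Gamma with h in Sigma, m in Z^k: h is (h, 0), m is (1, m).\<close>

definition sigma_elt :: "('g, 'b) monoid_scheme \<Rightarrow> ((('n::finite) \<Rightarrow> int) \<Rightarrow> 'g)
    \<Rightarrow> ((('n \<Rightarrow> int) \<Rightarrow> 'g) \<times> ('n \<Rightarrow> int))" where
  "sigma_elt G h = (h, \<lambda>_. 0)"

definition zk_elt :: "('g, 'b) monoid_scheme \<Rightarrow> (('n::finite) \<Rightarrow> int)
    \<Rightarrow> ((('n \<Rightarrow> int) \<Rightarrow> 'g) \<times> ('n \<Rightarrow> int))" where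
  "zk_elt G m = (\<lambda>_. \<one>\<^bsub>G\<^esub>, m)"

text \<open>phi' = restriction of phi to Sigma (as a map Sigma -> Gamma; Sigma is phi-invariant).
  phibar = induced automorphism of Gamma/Sigma, identified with Z^k via (h,m)Sigma |-> m,
  i.e. phibar(m) = Z^k-component of phi(m).
  phi1(h m) = phi'(h) phibar(m).\<close>

definition phi_bar :: "('g, 'b) monoid_scheme \<Rightarrow>
    (((('n::finite) \<Rightarrow> int) \<Rightarrow> 'g) \<times> ('n \<Rightarrow> int) \<Rightarrow> (('n \<Rightarrow> int) \<Rightarrow> 'g) \<times> ('n \<Rightarrow> int))
    \<Rightarrow> ('n \<Rightarrow> int) \<Rightarrow> ('n \<Rightarrow> int)" where
  "phi_bar G \<phi> m = snd (\<phi> (zk_elt G m))"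

definition phi_one :: "('g, 'b) monoid_scheme \<Rightarrow>
    (((('n::finite) \<Rightarrow> int) \<Rightarrow> 'g) \<times> ('n \<Rightarrow> int) \<Rightarrow> (('n \<Rightarrow> int) \<Rightarrow> 'g) \<times> ('n \<Rightarrow> int))
    \<Rightarrow> (('n \<Rightarrow> int) \<Rightarrow> 'g) \<times> ('n \<Rightarrow> int) \<Rightarrow> (('n \<Rightarrow> int) \<Rightarrow> 'g) \<times> ('n \<Rightarrow> int)" where
  "phi_one G \<phi> = (\<lambda>(h, m). \<phi> (sigma_elt G h) \<otimes>\<^bsub>wreath_Zk G\<^esub> zk_elt G (phi_bar G \<phi> m))"

text \<open>Twisted conjugacy (Reidemeister) relation x ~ g x psi(g^-1), and the Reidemeister number.\<close>

definition twisted_conj :: "('a, 'c) monoid_scheme \<Rightarrow> ('a \<Rightarrow> 'a) \<Rightarrow> ('a \<times> 'a) set" where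
  "twisted_conj \<Gamma> \<psi> = {(x, y). x \<in> carrier \<Gamma> \<and> y \<in> carrier \<Gamma> \<and>
     (\<exists>g \<in> carrier \<Gamma>. y = g \<otimes>\<^bsub>\<Gamma>\<^esub> x \<otimes>\<^bsub>\<Gamma>\<^esub> \<psi> (inv\<^bsub>\<Gamma>\<^esub> g))}"

definition reidemeister :: "('a, 'c) monoid_scheme \<Rightarrow> ('a \<Rightarrow> 'a) \<Rightarrow> enat" where
  "reidemeister \<Gamma> \<psi> = (if finite (carrier \<Gamma> // twisted_conj \<Gamma> \<psi>)
     then enat (card (carrier \<Gamma> // twisted_conj \<Gamma> \<psi>)) else \<infinity>)"

end

theory Submission
  imports Defs "HOL-Analysis.Analysis" "HOL-Library.Function_Algebras"
begin

text \<open>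
  Since \<open>\<Sigma>\<close> is the torsion subset, \<open>\<phi>\<close> preserves it; hence \<open>\<phi>\<close> and \<open>\<phi>\<^sub>1\<close> both act on the
  \<open>\<int>\<^sup>k\<close>-component by \<open>\<phi>bar\<close>, and they agree on \<open>\<Sigma>\<close>. Twisted conjugation by \<open>g\<close> moves the
  \<open>\<int>\<^sup>k\<close>-component by \<open>\<delta> m = m - \<phi>bar m\<close>, where \<open>m\<close> is the \<open>\<int>\<^sup>k\<close>-component of \<open>g\<close>. If either
  Reidemeister number is finite, pigeonhole gives every vector a positive multiple in the range of
  \<open>\<delta>\<close>, so \<open>\<delta>\<close> is injective. Fix a representative of each coset of the range of \<open>\<delta>\<close> and let
  \<open>T\<close> consist of the elements whose \<open>\<int>\<^sup>k\<close>-component is a chosen representative. Every twisted class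
  meets \<open>T\<close>, and two elements of \<open>T\<close> are twisted conjugate only by elements of \<open>\<Sigma>\<close>, where \<open>\<phi>\<close>
  and \<open>\<phi>\<^sub>1\<close> agree. So both sets of twisted classes are in bijection with the same quotient of \<open>T\<close>.
\<close>

section \<open>Additive maps of \<open>\<int>\<^sup>n\<close>\<close>

lemma sum_fun_apply: "(\<Sum>i\<in>A. g i) k = (\<Sum>i\<in>A. g i k)"
  by (induction A rule: infinite_finite_induct) auto

lemma additive_int_vector_scale:
  fixes f :: "('n \<Rightarrow> int) \<Rightarrow> 'm \<Rightarrow> int"
  assumes "Modules.additive f"
  shows "f (\<lambda>i. c * x i) = (\<lambda>k. c * f x k)"
proof -
  interpret additive f by fact
  have nat: "f (\<lambda>i. int n * x i) = (\<lambda>k. int n * f x k)" for n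
  proof (induction n)
    case 0
    then show ?case using zero by (simp add: zero_fun_def)
  next
    case (Suc n)
    have "(\<lambda>i. int (Suc n) * x i) = (\<lambda>i. int n * x i) + x"
      by (simp add: fun_eq_iff algebra_simps)
    then have "f (\<lambda>i. int (Suc n) * x i) = f (\<lambda>i. int n * x i) + f x"
      by (simp only: add)
    then show ?case using Suc by (simp add: fun_eq_iff algebra_simps)
  qed
  show ?thesis
  proof (cases c rule: int_cases)
    case (nonneg n)
    then show ?thesis by (simp add: nat)
  next
    case (neg n)
    then have "(\<lambda>i. c * x i) = - (\<lambda>i. int (Suc n) * x i)"
      by (simp only: mult_minus_left fun_Compl_def)
    then have "f (\<lambda>i. c * x i) = - f (\<lambda>i. int (Suc n) * x i)"
      by (simp only: minus)
    also have "\<dots> = (\<lambda>k. c * f x k)"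
      unfolding nat by (simp add: neg fun_eq_iff algebra_simps)
    finally show ?thesis .
  qed
qed

lemma additive_int_vector_expansion:
  fixes f :: "('n::finite \<Rightarrow> int) \<Rightarrow> 'm \<Rightarrow> int"
  assumes "Modules.additive f"
  shows "f x k = (\<Sum>i\<in>UNIV. x i * f (indicator {i}) k)"
proof -
  interpret additive f by fact
  have "x = (\<Sum>i\<in>UNIV. (\<lambda>j. x i * indicator {i} j))"
    by (simp add: fun_eq_iff sum_fun_apply indicator_def if_distrib cong: if_cong)
  then have "f x = (\<Sum>i\<in>UNIV. f (\<lambda>j. x i * indicator {i} j))"
    by (metis sum)
  then show ?thesis
    by (simp add: sum_fun_apply additive_int_vector_scale[OF assms])
qed

lemma additive_int_vector_inj:
  fixes f :: "('n::finite \<Rightarrow> int) \<Rightarrow> 'n \<Rightarrow> int"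
  assumes additive: "Modules.additive f"
    and multiple_in_range: "\<And>v. \<exists>j>0. \<exists>w. f w = (\<lambda>i. j * v i)"
  shows "inj f"
proof -
  \<comment> \<open>The real matrix of \<open>f\<close> has the standard basis in its range, so it is invertible.\<close>
  define A :: "real^'n^'n" where "A = (\<chi> k i. of_int (f (indicator {i}) k))"
  have extends_f: "A *v (\<chi> i. of_int (w i)) = (\<chi> k. of_int (f w k))" for w
    using additive_int_vector_expansion[OF additive, of w]
    by (simp add: A_def matrix_vector_mult_def vec_eq_iff mult.commute)
  have "Basis \<subseteq> range ((*v) A)"
  proof
    fix b :: "real^'n"
    assume "b \<in> Basis"
    then obtain i where b: "b = axis i 1" by (auto simp: Basis_vec_def)
    obtain j w where "j > 0" and w: "f w = (\<lambda>k. j * indicator {i} k)"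
      using multiple_in_range by blast
    then have "A *v ((1 / of_int j) *\<^sub>R (\<chi> i. of_int (w i))) = b"
      by (simp add: matrix_vector_mult_scaleR extends_f b axis_def vec_eq_iff indicator_def)
    then show "b \<in> range ((*v) A)" by (metis rangeI)
  qed
  then have "surj ((*v) A)"
    using span_minimal[OF _ linear_subspace_image[OF matrix_vector_mul_linear subspace_UNIV]]
    by (metis span_Basis top.extremum_uniqueI)
  then have "inj ((*v) A)"
    by (rule eucl.linear_surj_imp_inj[OF matrix_vector_mul_linear])
  show ?thesis
  proof (rule injI)
    fix x y
    assume "f x = f y"
    then have "A *v (\<chi> i. of_int (x i)) = A *v (\<chi> i. of_int (y i))"
      by (simp add: extends_f)
    then have "(\<chi> i. of_int (x i)) = (\<chi> i. of_int (y i) :: real^'n)"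
      using \<open>inj ((*v) A)\<close> by (simp add: inj_eq)
    then show "x = y" by (simp add: vec_eq_iff fun_eq_iff)
  qed
qed

section \<open>Twisted conjugacy\<close>

lemma twisted_conj_equiv:
  fixes \<Gamma> (structure)
  assumes "group \<Gamma>" and "\<psi> \<in> hom \<Gamma> \<Gamma>"
  shows "equiv (carrier \<Gamma>) (twisted_conj \<Gamma> \<psi>)"
proof -
  interpret group_hom \<Gamma> \<Gamma> \<psi>
    using assms by (simp add: group_hom_def group_hom_axioms_def)
  show ?thesis
  proof (rule equivI)
    show "twisted_conj \<Gamma> \<psi> \<subseteq> carrier \<Gamma> \<times> carrier \<Gamma>"
      by (auto simp: twisted_conj_def)
  next
    show "refl_on (carrier \<Gamma>) (twisted_conj \<Gamma> \<psi>)"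
    proof (rule refl_onI)
      fix x
      assume x: "x \<in> carrier \<Gamma>"
      then have "x = \<one> \<otimes> x \<otimes> \<psi> (inv \<one>)" by simp
      then show "(x, x) \<in> twisted_conj \<Gamma> \<psi>"
        using x unfolding twisted_conj_def by blast
    qed
  next
    show "sym (twisted_conj \<Gamma> \<psi>)"
    proof (rule symI)
      fix x y
      assume "(x, y) \<in> twisted_conj \<Gamma> \<psi>"
      then obtain g where x: "x \<in> carrier \<Gamma>" and y: "y \<in> carrier \<Gamma>" and g: "g \<in> carrier \<Gamma>"
        and y_eq: "y = g \<otimes> x \<otimes> \<psi> (inv g)"
        by (auto simp: twisted_conj_def)
      have "x = inv g \<otimes> y \<otimes> \<psi> (inv (inv g))"
        using x g by (simp add: y_eq hom_inv m_assoc flip: m_assoc[of "inv g" g x])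
      then show "(y, x) \<in> twisted_conj \<Gamma> \<psi>"
        using x y g unfolding twisted_conj_def by blast
    qed
  next
    show "trans (twisted_conj \<Gamma> \<psi>)"
    proof (rule transI)
      fix x y z
      assume "(x, y) \<in> twisted_conj \<Gamma> \<psi>" and "(y, z) \<in> twisted_conj \<Gamma> \<psi>"
      then obtain g k where x: "x \<in> carrier \<Gamma>" and z: "z \<in> carrier \<Gamma>"
        and g: "g \<in> carrier \<Gamma>" and k: "k \<in> carrier \<Gamma>"
        and y_eq: "y = g \<otimes> x \<otimes> \<psi> (inv g)" and z_eq: "z = k \<otimes> y \<otimes> \<psi> (inv k)"
        by (auto simp: twisted_conj_def)
      have "z = (k \<otimes> g) \<otimes> x \<otimes> \<psi> (inv (k \<otimes> g))"
        using x g k by (simp add: y_eq z_eq hom_inv m_assoc inv_mult_group)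
      then show "(x, z) \<in> twisted_conj \<Gamma> \<psi>"
        using x z g k unfolding twisted_conj_def by blast
    qed
  qed
qed

lemma bij_betw_quotient_restrict:
  assumes equiv: "equiv A E" and "T \<subseteq> A"
    and meets: "\<And>x. x \<in> A \<Longrightarrow> \<exists>t\<in>T. (x, t) \<in> E"
  shows "bij_betw (\<lambda>P. P \<inter> T) (A // E) (T // (E \<inter> T \<times> T))"
proof -
  have restrict_class: "E `` {x} \<inter> T = (E \<inter> T \<times> T) `` {t}" if "(x, t) \<in> E" "t \<in> T" for x t
    using equiv_class_eq[OF equiv that(1)] that(2) by auto
  show ?thesis
  proof (rule bij_betw_imageI)
    show "inj_on (\<lambda>P. P \<inter> T) (A // E)"
    proof (rule inj_onI)
      fix P Q
      assume "P \<in> A // E" "Q \<in> A // E" and PQ: "P \<inter> T = Q \<inter> T"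
      then obtain x y where x: "x \<in> A" "P = E `` {x}" and y: "y \<in> A" "Q = E `` {y}"
        by (auto elim!: quotientE)
      obtain t where t: "t \<in> T" "(x, t) \<in> E" using meets[OF x(1)] by blast
      then have "(y, t) \<in> E" using PQ x y by auto
      then show "P = Q" using x y t equiv_class_eq[OF equiv] by metis
    qed
  next
    show "(\<lambda>P. P \<inter> T) ` (A // E) = T // (E \<inter> T \<times> T)"
    proof (intro equalityI subsetI)
      fix S
      assume "S \<in> (\<lambda>P. P \<inter> T) ` (A // E)"
      then obtain x where x: "x \<in> A" "S = E `` {x} \<inter> T" by (auto elim!: quotientE)
      obtain t where "t \<in> T" "(x, t) \<in> E" using meets[OF x(1)] by blast
      then show "S \<in> T // (E \<inter> T \<times> T)"
        using restrict_class x by (auto intro: quotientI)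
    next
      fix S
      assume "S \<in> T // (E \<inter> T \<times> T)"
      then obtain t where t: "t \<in> T" "S = (E \<inter> T \<times> T) `` {t}" by (auto elim!: quotientE)
      with \<open>T \<subseteq> A\<close> have "t \<in> A" and "(t, t) \<in> E"
        using equiv by (auto simp: equiv_def refl_on_def)
      then show "S \<in> (\<lambda>P. P \<inter> T) ` (A // E)"
        using restrict_class t by (auto intro: quotientI)
    qed
  qed
qed

lemma reidemeister_eq_if_agree_on_transversal:
  fixes \<Gamma> (structure)
  assumes "group \<Gamma>" and "\<psi>\<^sub>1 \<in> hom \<Gamma> \<Gamma>" and "\<psi>\<^sub>2 \<in> hom \<Gamma> \<Gamma>" and "T \<subseteq> carrier \<Gamma>"
    and "\<And>x. x \<in> carrier \<Gamma> \<Longrightarrow> \<exists>t\<in>T. (x, t) \<in> twisted_conj \<Gamma> \<psi>\<^sub>1"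
    and "\<And>x. x \<in> carrier \<Gamma> \<Longrightarrow> \<exists>t\<in>T. (x, t) \<in> twisted_conj \<Gamma> \<psi>\<^sub>2"
    and agree: "twisted_conj \<Gamma> \<psi>\<^sub>1 \<inter> T \<times> T = twisted_conj \<Gamma> \<psi>\<^sub>2 \<inter> T \<times> T"
  shows "reidemeister \<Gamma> \<psi>\<^sub>1 = reidemeister \<Gamma> \<psi>\<^sub>2"
proof -
  have bij1: "bij_betw (\<lambda>P. P \<inter> T) (carrier \<Gamma> // twisted_conj \<Gamma> \<psi>\<^sub>1) (T // (twisted_conj \<Gamma> \<psi>\<^sub>1 \<inter> T \<times> T))"
    by (rule bij_betw_quotient_restrict) (use assms twisted_conj_equiv in auto)
  have bij2: "bij_betw (\<lambda>P. P \<inter> T) (carrier \<Gamma> // twisted_conj \<Gamma> \<psi>\<^sub>2) (T // (twisted_conj \<Gamma> \<psi>\<^sub>1 \<inter> T \<times> T))"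
    unfolding agree by (rule bij_betw_quotient_restrict) (use assms twisted_conj_equiv in auto)
  show ?thesis
    using bij_betw_same_card[OF bij1] bij_betw_same_card[OF bij2]
      bij_betw_finite[OF bij1] bij_betw_finite[OF bij2]
    by (simp add: reidemeister_def)
qed

section \<open>The wreath product\<close>

type_synonym ('n, 'g) wreath_elt = "(('n \<Rightarrow> int) \<Rightarrow> 'g) \<times> ('n \<Rightarrow> int)"

lemma carrier_wreath_Zk:
  "x \<in> carrier (wreath_Zk G) \<longleftrightarrow> (\<forall>z. fst x z \<in> carrier G) \<and> finite {z. fst x z \<noteq> \<one>\<^bsub>G\<^esub>}"
  by (cases x) (simp add: wreath_Zk_def)

lemma mult_wreath_Zk:
  "x \<otimes>\<^bsub>wreath_Zk G\<^esub> y = (\<lambda>z. fst x z \<otimes>\<^bsub>G\<^esub> fst y (z - snd x), snd x + snd y)"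
  by (simp add: wreath_Zk_def fun_diff_def plus_fun_def)

lemma one_wreath_Zk: "\<one>\<^bsub>wreath_Zk G\<^esub> = (\<lambda>_. \<one>\<^bsub>G\<^esub>, 0)"
  by (simp add: wreath_Zk_def zero_fun_def)

lemma finite_support_shift:
  fixes h :: "('n \<Rightarrow> int) \<Rightarrow> 'a"
  assumes "finite {z. h z \<noteq> c}"
  shows "finite {z. h (z - m) \<noteq> c}"
  using finite_vimageI[OF assms, of "\<lambda>z. z - m"] by (simp add: inj_def vimage_def)

lemma group_wreath_Zk:
  fixes G :: "('g, 'b) monoid_scheme"
  assumes "group G"
  shows "group (wreath_Zk G :: ('n::finite, 'g) wreath_elt monoid)"
proof -
  interpret G: group G by fact
  have support_mult: "{z. a z \<otimes>\<^bsub>G\<^esub> b z \<noteq> \<one>\<^bsub>G\<^esub>} \<subseteq> {z. a z \<noteq> \<one>\<^bsub>G\<^esub>} \<union> {z. b z \<noteq> \<one>\<^bsub>G\<^esub>}"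
    if "\<And>z. b z \<in> carrier G" for a b :: "('n \<Rightarrow> int) \<Rightarrow> 'g"
    using that by auto
  show ?thesis
  proof (rule groupI)
    fix x y :: "('n, 'g) wreath_elt"
    assume "x \<in> carrier (wreath_Zk G)" and "y \<in> carrier (wreath_Zk G)"
    then show "x \<otimes>\<^bsub>wreath_Zk G\<^esub> y \<in> carrier (wreath_Zk G)"
      using support_mult[of "\<lambda>z. fst y (z - snd x)" "fst x"]
      by (auto simp: carrier_wreath_Zk mult_wreath_Zk
          intro: finite_subset[OF _ finite_UnI[OF _ finite_support_shift]])
  next
    fix x y z :: "('n, 'g) wreath_elt"
    assume "x \<in> carrier (wreath_Zk G)" "y \<in> carrier (wreath_Zk G)" "z \<in> carrier (wreath_Zk G)"
    then show "x \<otimes>\<^bsub>wreath_Zk G\<^esub> y \<otimes>\<^bsub>wreath_Zk G\<^esub> z = x \<otimes>\<^bsub>wreath_Zk G\<^esub> (y \<otimes>\<^bsub>wreath_Zk G\<^esub> z)"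
      by (simp add: mult_wreath_Zk carrier_wreath_Zk G.m_assoc diff_diff_eq add.assoc)
  next
    fix x :: "('n, 'g) wreath_elt"
    assume x: "x \<in> carrier (wreath_Zk G)"
    define y where "y = (\<lambda>z. inv\<^bsub>G\<^esub> fst x (z + snd x), - snd x)"
    have "y \<in> carrier (wreath_Zk G)"
      using x finite_support_shift[of "fst x" "\<one>\<^bsub>G\<^esub>" "- snd x"]
      by (simp add: y_def carrier_wreath_Zk)
    moreover have "y \<otimes>\<^bsub>wreath_Zk G\<^esub> x = \<one>\<^bsub>wreath_Zk G\<^esub>"
      using x by (simp add: y_def mult_wreath_Zk one_wreath_Zk carrier_wreath_Zk)
    ultimately show "\<exists>y\<in>carrier (wreath_Zk G). y \<otimes>\<^bsub>wreath_Zk G\<^esub> x = \<one>\<^bsub>wreath_Zk G\<^esub>" by blast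
  qed (auto simp: carrier_wreath_Zk mult_wreath_Zk one_wreath_Zk)
qed

lemma sigma_elt_eq: "sigma_elt G h = (h, 0)"
  by (simp add: sigma_elt_def zero_fun_def)

lemma zk_elt_eq: "zk_elt G m = (\<lambda>_. \<one>\<^bsub>G\<^esub>, m)"
  by (simp add: zk_elt_def)

lemma sigma_elt_closed:
  "sigma_elt G h \<in> carrier (wreath_Zk G) \<longleftrightarrow> (\<forall>z. h z \<in> carrier G) \<and> finite {z. h z \<noteq> \<one>\<^bsub>G\<^esub>}"
  by (simp add: sigma_elt_def carrier_wreath_Zk)

lemma sigma_elt_fst_closed:
  "x \<in> carrier (wreath_Zk G) \<Longrightarrow> sigma_elt G (fst x) \<in> carrier (wreath_Zk G)"
  by (simp add: sigma_elt_eq carrier_wreath_Zk)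

lemma zk_elt_closed:
  assumes "monoid G"
  shows "zk_elt G m \<in> carrier (wreath_Zk G)"
  using assms by (simp add: zk_elt_eq carrier_wreath_Zk)

lemma sigma_elt_mult:
  "sigma_elt G h \<otimes>\<^bsub>wreath_Zk G\<^esub> sigma_elt G h' = sigma_elt G (\<lambda>z. h z \<otimes>\<^bsub>G\<^esub> h' z)"
  by (simp add: sigma_elt_eq mult_wreath_Zk)

lemma zk_elt_mult:
  assumes "monoid G"
  shows "zk_elt G m \<otimes>\<^bsub>wreath_Zk G\<^esub> zk_elt G n = zk_elt G (m + n)"
  using assms by (simp add: zk_elt_eq mult_wreath_Zk)

lemma sigma_elt_zk_elt_commute:
  assumes "monoid G" and "\<And>z. h z \<in> carrier G"
  shows "sigma_elt G (\<lambda>z. h (z - m)) \<otimes>\<^bsub>wreath_Zk G\<^esub> zk_elt G m = zk_elt G m \<otimes>\<^bsub>wreath_Zk G\<^esub> sigma_elt G h"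
  using assms by (simp add: sigma_elt_eq zk_elt_eq mult_wreath_Zk)

lemma sigma_elt_zk_elt_decompose:
  assumes "monoid G" and "x \<in> carrier (wreath_Zk G)"
  shows "sigma_elt G (fst x) \<otimes>\<^bsub>wreath_Zk G\<^esub> zk_elt G (snd x) = x"
  using assms by (simp add: sigma_elt_eq zk_elt_eq mult_wreath_Zk carrier_wreath_Zk prod_eq_iff)

lemma snd_inv_wreath_Zk:
  assumes "group G" and "x \<in> carrier (wreath_Zk G)"
  shows "snd (inv\<^bsub>wreath_Zk G\<^esub> x) = - snd x"
proof -
  have "x \<otimes>\<^bsub>wreath_Zk G\<^esub> inv\<^bsub>wreath_Zk G\<^esub> x = \<one>\<^bsub>wreath_Zk G\<^esub>"
    using group.r_inv[OF group_wreath_Zk] assms by blast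
  then have "snd x + snd (inv\<^bsub>wreath_Zk G\<^esub> x) = 0"
    by (simp add: mult_wreath_Zk one_wreath_Zk)
  then show ?thesis by (simp add: eq_neg_iff_add_eq_0 add.commute)
qed

lemma snd_pow_wreath_Zk: "snd (x [^]\<^bsub>wreath_Zk G\<^esub> (n::nat)) = (\<lambda>i. int n * snd x i)"
  by (induction n) (simp_all add: mult_wreath_Zk one_wreath_Zk algebra_simps fun_eq_iff)

lemma pow_sigma_elt_wreath_Zk:
  "sigma_elt G h [^]\<^bsub>wreath_Zk G\<^esub> (n::nat) = sigma_elt G (\<lambda>z. h z [^]\<^bsub>G\<^esub> n)"
  by (induction n) (simp_all add: sigma_elt_eq mult_wreath_Zk one_wreath_Zk)

lemma snd_eq_0_iff_pow_order_wreath_Zk: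
  assumes "group G" and "finite (carrier G)" and x: "x \<in> carrier (wreath_Zk G)"
  shows "snd x = 0 \<longleftrightarrow> x [^]\<^bsub>wreath_Zk G\<^esub> Coset.order G = \<one>\<^bsub>wreath_Zk G\<^esub>"
proof
  assume "snd x = 0"
  then have "x [^]\<^bsub>wreath_Zk G\<^esub> Coset.order G = sigma_elt G (\<lambda>z. fst x z [^]\<^bsub>G\<^esub> Coset.order G)"
    by (metis pow_sigma_elt_wreath_Zk sigma_elt_eq prod.collapse)
  also have "\<dots> = \<one>\<^bsub>wreath_Zk G\<^esub>"
    using x assms
    by (simp add: sigma_elt_eq one_wreath_Zk carrier_wreath_Zk group.pow_order_eq_1)
  finally show "x [^]\<^bsub>wreath_Zk G\<^esub> Coset.order G = \<one>\<^bsub>wreath_Zk G\<^esub>" .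
next
  assume pow: "x [^]\<^bsub>wreath_Zk G\<^esub> Coset.order G = \<one>\<^bsub>wreath_Zk G\<^esub>"
  have "(\<lambda>i. int (Coset.order G) * snd x i) = snd (x [^]\<^bsub>wreath_Zk G\<^esub> Coset.order G)"
    by (simp only: snd_pow_wreath_Zk)
  also have "\<dots> = 0"
    by (simp add: pow one_wreath_Zk)
  finally have "(\<lambda>i. int (Coset.order G) * snd x i) = 0" .
  moreover have "Coset.order G > 0"
    using assms by (simp add: group.is_monoid monoid.order_gt_0_iff_finite)
  ultimately show "snd x = 0" by (simp add: fun_eq_iff)
qed

section \<open>Automorphisms of the wreath product\<close>

locale wreath_Zk_automorphism = G: comm_group G for G :: "('g, 'b) monoid_scheme" +
  fixes \<phi> :: "('n::finite, 'g) wreath_elt \<Rightarrow> ('n, 'g) wreath_elt"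
  assumes finite_carrier: "finite (carrier G)"
    and iso: "\<phi> \<in> iso (wreath_Zk G) (wreath_Zk G)"
begin

abbreviation W :: "('n, 'g) wreath_elt monoid" where "W \<equiv> wreath_Zk G"

abbreviation \<phi>bar :: "('n \<Rightarrow> int) \<Rightarrow> 'n \<Rightarrow> int" where "\<phi>bar \<equiv> phi_bar G \<phi>"

definition \<phi>' :: "(('n \<Rightarrow> int) \<Rightarrow> 'g) \<Rightarrow> ('n \<Rightarrow> int) \<Rightarrow> 'g"
  where "\<phi>' h = fst (\<phi> (sigma_elt G h))"

sublocale W: group W
  by (rule group_wreath_Zk[OF G.is_group])

sublocale \<phi>: group_hom W W \<phi>
  using iso by (simp add: group_hom_def group_hom_axioms_def iso_def W.is_group)

lemma phi_bij: "bij_betw \<phi> (carrier W) (carrier W)"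
  using iso by (simp add: iso_def)

lemma snd_phi_eq_0_iff:
  assumes x: "x \<in> carrier W"
  shows "snd (\<phi> x) = 0 \<longleftrightarrow> snd x = 0"
proof -
  note torsion = snd_eq_0_iff_pow_order_wreath_Zk[OF G.is_group finite_carrier]
  have "\<phi> x [^]\<^bsub>W\<^esub> Coset.order G = \<one>\<^bsub>W\<^esub> \<longleftrightarrow> \<phi> (x [^]\<^bsub>W\<^esub> Coset.order G) = \<phi> \<one>\<^bsub>W\<^esub>"
    using x by (simp add: \<phi>.hom_nat_pow)
  also have "\<dots> \<longleftrightarrow> x [^]\<^bsub>W\<^esub> Coset.order G = \<one>\<^bsub>W\<^esub>"
    using phi_bij x by (metis bij_betw_def inj_on_eq_iff W.nat_pow_closed W.one_closed)
  finally show ?thesis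
    using torsion[OF x] torsion[OF \<phi>.hom_closed[OF x]] by simp
qed

lemma phi_sigma_elt:
  assumes "sigma_elt G h \<in> carrier W"
  shows "\<phi> (sigma_elt G h) = sigma_elt G (\<phi>' h)"
  using snd_phi_eq_0_iff[OF assms] by (simp add: \<phi>'_def sigma_elt_eq prod_eq_iff)

lemma sigma_elt_phi'_closed:
  assumes "sigma_elt G h \<in> carrier W"
  shows "sigma_elt G (\<phi>' h) \<in> carrier W"
  using phi_sigma_elt[OF assms] \<phi>.hom_closed[OF assms] by simp

lemma phi'_closed:
  assumes "sigma_elt G h \<in> carrier W"
  shows "\<phi>' h z \<in> carrier G"
  using sigma_elt_phi'_closed[OF assms] by (simp add: sigma_elt_closed)

lemma snd_phi:
  assumes x: "x \<in> carrier W"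
  shows "snd (\<phi> x) = \<phi>bar (snd x)"
proof -
  have sigma: "sigma_elt G (fst x) \<in> carrier W"
    using x by (rule sigma_elt_fst_closed)
  have "\<phi> x = \<phi> (sigma_elt G (fst x)) \<otimes>\<^bsub>W\<^esub> \<phi> (zk_elt G (snd x))"
    using sigma_elt_zk_elt_decompose[OF G.is_monoid x] sigma zk_elt_closed[OF G.is_monoid]
    by (metis \<phi>.hom_mult)
  then show ?thesis
    using phi_sigma_elt[OF sigma] by (simp add: sigma_elt_eq mult_wreath_Zk phi_bar_def)
qed

lemma phi_bar_add: "\<phi>bar (m + n) = \<phi>bar m + \<phi>bar n"
proof -
  have "\<phi> (zk_elt G (m + n)) = \<phi> (zk_elt G m) \<otimes>\<^bsub>W\<^esub> \<phi> (zk_elt G n)"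
    using zk_elt_mult[OF G.is_monoid] zk_elt_closed[OF G.is_monoid] by (metis \<phi>.hom_mult)
  then show ?thesis by (simp add: phi_bar_def mult_wreath_Zk)
qed

lemma additive_phi_bar: "Modules.additive \<phi>bar"
  by (rule additive.intro) (rule phi_bar_add)

lemma inj_phi_bar: "inj \<phi>bar"
proof -
  interpret additive \<phi>bar by (rule additive_phi_bar)
  have kernel: "m = 0" if "\<phi>bar m = 0" for m
    using that snd_phi_eq_0_iff[OF zk_elt_closed[OF G.is_monoid]]
    by (simp add: phi_bar_def zk_elt_eq)
  show ?thesis
  proof (rule injI)
    fix m n
    assume "\<phi>bar m = \<phi>bar n"
    then have "\<phi>bar (m - n) = 0" by (simp add: diff)
    then show "m = n" using kernel[of "m - n"] by simp
  qed
qed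

lemma surj_phi_bar: "surj \<phi>bar"
proof -
  have "\<exists>m. \<phi>bar m = p" for p
  proof -
    have "zk_elt G p \<in> \<phi> ` carrier W"
      using phi_bij zk_elt_closed[OF G.is_monoid] by (simp add: bij_betw_def)
    then obtain x where x: "x \<in> carrier W" and "\<phi> x = zk_elt G p" by auto
    then have "\<phi>bar (snd x) = p"
      using snd_phi[OF x] by (simp add: zk_elt_eq)
    then show ?thesis by blast
  qed
  then show ?thesis by (metis surjI)
qed

lemma phi'_mult:
  assumes "sigma_elt G h \<in> carrier W" and "sigma_elt G h' \<in> carrier W"
  shows "\<phi>' (\<lambda>z. h z \<otimes>\<^bsub>G\<^esub> h' z) = (\<lambda>z. \<phi>' h z \<otimes>\<^bsub>G\<^esub> \<phi>' h' z)"
proof -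
  have "sigma_elt G (\<phi>' (\<lambda>z. h z \<otimes>\<^bsub>G\<^esub> h' z)) = \<phi> (sigma_elt G h \<otimes>\<^bsub>W\<^esub> sigma_elt G h')"
    using phi_sigma_elt W.m_closed[OF assms] by (simp add: sigma_elt_mult)
  also have "\<dots> = sigma_elt G (\<lambda>z. \<phi>' h z \<otimes>\<^bsub>G\<^esub> \<phi>' h' z)"
    unfolding \<phi>.hom_mult[OF assms] phi_sigma_elt[OF assms(1)] phi_sigma_elt[OF assms(2)]
    by (rule sigma_elt_mult)
  finally show ?thesis by (simp add: sigma_elt_eq)
qed

text \<open>The only place where commutativity of \<open>G\<close> is used.\<close>

lemma phi'_shift:
  assumes h: "sigma_elt G h \<in> carrier W"
  shows "\<phi>' (\<lambda>z. h (z - m)) = (\<lambda>z. \<phi>' h (z - \<phi>bar m))"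
proof -
  have h_closed: "\<And>z. h z \<in> carrier G"
    using h by (simp add: sigma_elt_closed)
  have shifted: "sigma_elt G (\<lambda>z. h (z - m)) \<in> carrier W"
    using h by (simp add: sigma_elt_closed finite_support_shift)
  define s where "s = fst (\<phi> (zk_elt G m))"
  have s_closed: "\<And>z. s z \<in> carrier G"
    using \<phi>.hom_closed[OF zk_elt_closed[OF G.is_monoid]] by (simp add: s_def carrier_wreath_Zk)
  have phi_zk: "\<phi> (zk_elt G m) = (s, \<phi>bar m)"
    by (simp add: s_def phi_bar_def)
  have zk: "zk_elt G m \<in> carrier W"
    by (rule zk_elt_closed[OF G.is_monoid])
  have "\<phi> (sigma_elt G (\<lambda>z. h (z - m))) \<otimes>\<^bsub>W\<^esub> \<phi> (zk_elt G m)
      = \<phi> (zk_elt G m) \<otimes>\<^bsub>W\<^esub> \<phi> (sigma_elt G h)"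
    using sigma_elt_zk_elt_commute[of G h m] G.is_monoid h_closed
    by (simp only: \<phi>.hom_mult[OF shifted zk, symmetric] \<phi>.hom_mult[OF zk h, symmetric])
  then have "sigma_elt G (\<phi>' (\<lambda>z. h (z - m))) \<otimes>\<^bsub>W\<^esub> (s, \<phi>bar m)
      = (s, \<phi>bar m) \<otimes>\<^bsub>W\<^esub> sigma_elt G (\<phi>' h)"
    by (simp only: phi_sigma_elt[OF shifted] phi_sigma_elt[OF h] phi_zk)
  then have "\<phi>' (\<lambda>z. h (z - m)) z \<otimes>\<^bsub>G\<^esub> s z = s z \<otimes>\<^bsub>G\<^esub> \<phi>' h (z - \<phi>bar m)" for z
    by (simp add: sigma_elt_eq mult_wreath_Zk fun_eq_iff)
  then have "s z \<otimes>\<^bsub>G\<^esub> \<phi>' (\<lambda>z. h (z - m)) z = s z \<otimes>\<^bsub>G\<^esub> \<phi>' h (z - \<phi>bar m)" for z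
    using G.m_comm[OF phi'_closed[OF shifted] s_closed] by simp
  then show ?thesis
    using s_closed phi'_closed[OF h] phi'_closed[OF shifted] by (simp add: fun_eq_iff)
qed

lemma phi_one_eq:
  assumes x: "x \<in> carrier W"
  shows "phi_one G \<phi> x = (\<phi>' (fst x), \<phi>bar (snd x))"
proof -
  have "phi_one G \<phi> x = sigma_elt G (\<phi>' (fst x)) \<otimes>\<^bsub>W\<^esub> zk_elt G (\<phi>bar (snd x))"
    by (simp add: phi_one_def case_prod_beta phi_sigma_elt[OF sigma_elt_fst_closed[OF x]])
  also have "\<dots> = (\<phi>' (fst x), \<phi>bar (snd x))"
    using phi'_closed[OF sigma_elt_fst_closed[OF x]] by (simp add: sigma_elt_eq zk_elt_eq mult_wreath_Zk)
  finally show ?thesis .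
qed

lemma snd_phi_one: "x \<in> carrier W \<Longrightarrow> snd (phi_one G \<phi> x) = \<phi>bar (snd x)"
  by (simp add: phi_one_eq)

lemma phi_one_eq_phi:
  assumes x: "x \<in> carrier W" and "snd x = 0"
  shows "phi_one G \<phi> x = \<phi> x"
proof -
  have x_eq: "sigma_elt G (fst x) = x"
    using assms(2) by (simp add: sigma_elt_eq prod_eq_iff)
  have "phi_one G \<phi> x = (\<phi>' (fst x), \<phi>bar 0)"
    using phi_one_eq[OF x] assms(2) by simp
  also have "\<dots> = sigma_elt G (\<phi>' (fst x))"
    by (simp add: additive.zero[OF additive_phi_bar] sigma_elt_eq)
  also have "\<dots> = \<phi> (sigma_elt G (fst x))"
    by (rule phi_sigma_elt[OF sigma_elt_fst_closed[OF x], symmetric])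
  also have "\<dots> = \<phi> x"
    unfolding x_eq ..
  finally show ?thesis .
qed

lemma phi_one_hom: "phi_one G \<phi> \<in> hom W W"
proof (rule homI)
  fix x
  assume "x \<in> carrier W"
  then show "phi_one G \<phi> x \<in> carrier W"
    using sigma_elt_phi'_closed[OF sigma_elt_fst_closed]
    by (simp add: phi_one_eq carrier_wreath_Zk sigma_elt_eq)
next
  fix x y
  assume x: "x \<in> carrier W" and y: "y \<in> carrier W"
  have "fst (x \<otimes>\<^bsub>W\<^esub> y) = (\<lambda>z. fst x z \<otimes>\<^bsub>G\<^esub> fst y (z - snd x))"
    by (simp add: mult_wreath_Zk)
  moreover have "sigma_elt G (\<lambda>z. fst y (z - snd x)) \<in> carrier W"
    using y by (simp add: sigma_elt_eq carrier_wreath_Zk finite_support_shift)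
  ultimately have fst_mult: "\<phi>' (fst (x \<otimes>\<^bsub>W\<^esub> y))
      = (\<lambda>z. \<phi>' (fst x) z \<otimes>\<^bsub>G\<^esub> \<phi>' (fst y) (z - \<phi>bar (snd x)))"
    using phi'_mult[OF sigma_elt_fst_closed[OF x]] phi'_shift[OF sigma_elt_fst_closed[OF y]] by simp
  have "phi_one G \<phi> (x \<otimes>\<^bsub>W\<^esub> y) = (\<phi>' (fst (x \<otimes>\<^bsub>W\<^esub> y)), \<phi>bar (snd (x \<otimes>\<^bsub>W\<^esub> y)))"
    by (rule phi_one_eq[OF W.m_closed[OF x y]])
  also have "\<dots> = (\<phi>' (fst x), \<phi>bar (snd x)) \<otimes>\<^bsub>W\<^esub> (\<phi>' (fst y), \<phi>bar (snd y))"
    unfolding fst_mult by (simp add: mult_wreath_Zk phi_bar_add)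
  finally show "phi_one G \<phi> (x \<otimes>\<^bsub>W\<^esub> y) = phi_one G \<phi> x \<otimes>\<^bsub>W\<^esub> phi_one G \<phi> y"
    by (simp only: phi_one_eq x y)
qed

lemma inj_on_phi_one: "inj_on (phi_one G \<phi>) (carrier W)"
proof (rule inj_onI)
  fix x y
  assume x: "x \<in> carrier W" and y: "y \<in> carrier W" and "phi_one G \<phi> x = phi_one G \<phi> y"
  then have "\<phi>' (fst x) = \<phi>' (fst y)" and "\<phi>bar (snd x) = \<phi>bar (snd y)"
    by (simp_all add: phi_one_eq)
  then have "\<phi> (sigma_elt G (fst x)) = \<phi> (sigma_elt G (fst y))" and "snd x = snd y"
    unfolding phi_sigma_elt[OF sigma_elt_fst_closed[OF x]] phi_sigma_elt[OF sigma_elt_fst_closed[OF y]]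
    using inj_phi_bar by (simp_all add: inj_eq)
  moreover have "inj_on \<phi> (carrier W)"
    using phi_bij by (simp add: bij_betw_def)
  ultimately have "sigma_elt G (fst x) = sigma_elt G (fst y)"
    using sigma_elt_fst_closed[OF x] sigma_elt_fst_closed[OF y] by (auto dest: inj_onD)
  with \<open>snd x = snd y\<close> show "x = y"
    by (simp add: sigma_elt_eq prod_eq_iff)
qed

lemma carrier_subset_phi_one_image: "carrier W \<subseteq> phi_one G \<phi> ` carrier W"
proof
  fix y
  assume y: "y \<in> carrier W"
  have "sigma_elt G (fst y) \<in> \<phi> ` carrier W"
    using phi_bij sigma_elt_fst_closed[OF y] by (simp add: bij_betw_def)
  then obtain x where x: "x \<in> carrier W" and phi_x: "\<phi> x = sigma_elt G (fst y)" by auto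
  then have "snd x = 0"
    using snd_phi_eq_0_iff[OF x] by (simp add: sigma_elt_eq)
  then have x_eq: "sigma_elt G (fst x) = x"
    by (simp add: sigma_elt_eq prod_eq_iff)
  obtain m where m: "snd y = \<phi>bar m"
    using surjD[OF surj_phi_bar] by blast
  have closed: "(fst x, m) \<in> carrier W"
    using x by (simp add: carrier_wreath_Zk)
  have "\<phi>' (fst x) = fst (\<phi> x)"
    unfolding \<phi>'_def x_eq ..
  then have "\<phi>' (fst x) = fst y"
    using phi_x by (simp add: sigma_elt_eq)
  then have "y = phi_one G \<phi> (fst x, m)"
    using phi_one_eq[OF closed] by (simp add: m prod_eq_iff)
  then show "y \<in> phi_one G \<phi> ` carrier W"
    using closed by (rule image_eqI)
qed

lemma phi_one_iso: "phi_one G \<phi> \<in> iso W W"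
proof -
  have "bij_betw (phi_one G \<phi>) (carrier W) (carrier W)"
    using inj_on_phi_one carrier_subset_phi_one_image hom_carrier[OF phi_one_hom]
    by (simp add: bij_betw_def)
  then show ?thesis
    using phi_one_hom by (simp add: iso_def)
qed

section \<open>Reidemeister numbers\<close>

definition \<delta> :: "('n \<Rightarrow> int) \<Rightarrow> 'n \<Rightarrow> int"
  where "\<delta> m = m - \<phi>bar m"

lemma additive_delta: "Modules.additive \<delta>"
  by (rule additive.intro) (simp add: \<delta>_def phi_bar_add)

definition coset_rep :: "('n \<Rightarrow> int) \<Rightarrow> 'n \<Rightarrow> int"
  where "coset_rep m = (SOME r. r - m \<in> range \<delta>)"

definition transversal :: "('n, 'g) wreath_elt set"
  where "transversal = {x \<in> carrier W. coset_rep (snd x) = snd x}"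

lemma coset_rep_diff: "coset_rep m - m \<in> range \<delta>"
proof -
  have "m - m \<in> range \<delta>"
    using additive.zero[OF additive_delta] by (metis diff_self rangeI)
  then show ?thesis
    unfolding coset_rep_def by (rule someI[where P = "\<lambda>r. r - m \<in> range \<delta>"])
qed

lemma coset_rep_eq:
  assumes "r - m \<in> range \<delta>"
  shows "coset_rep r = coset_rep m"
proof -
  interpret additive \<delta> by (rule additive_delta)
  obtain u where u: "r - m = \<delta> u" using assms by blast
  have "s - r \<in> range \<delta> \<longleftrightarrow> s - m \<in> range \<delta>" for s
  proof
    assume "s - r \<in> range \<delta>"
    then obtain v where "s - r = \<delta> v" by blast
    then have "s - m = \<delta> (v + u)" using u by (simp add: add algebra_simps)
    then show "s - m \<in> range \<delta>" by blast
  next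
    assume "s - m \<in> range \<delta>"
    then obtain v where "s - m = \<delta> v" by blast
    then have "s - r = \<delta> (v - u)" using u by (simp add: diff algebra_simps)
    then show "s - r \<in> range \<delta>" by blast
  qed
  then show ?thesis by (simp add: coset_rep_def)
qed

lemma transversal_subset: "transversal \<subseteq> carrier W"
  by (auto simp: transversal_def)

end

text \<open>Any endomorphism inducing \<open>\<phi>bar\<close> on \<open>\<int>\<^sup>k\<close>; it is instantiated with both \<open>\<phi>\<close> and \<open>\<phi>\<^sub>1\<close>.\<close>

locale wreath_Zk_lift = wreath_Zk_automorphism G \<phi>
  for G :: "('g, 'b) monoid_scheme" and \<phi> :: "('n::finite, 'g) wreath_elt \<Rightarrow> ('n, 'g) wreath_elt" +
  fixes \<psi> :: "('n, 'g) wreath_elt \<Rightarrow> ('n, 'g) wreath_elt"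
  assumes \<psi>_hom: "\<psi> \<in> hom (wreath_Zk G) (wreath_Zk G)"
    and snd_\<psi>: "\<And>x. x \<in> carrier (wreath_Zk G) \<Longrightarrow> snd (\<psi> x) = phi_bar G \<phi> (snd x)"
begin

lemma twisted_conj_closed:
  "g \<in> carrier W \<Longrightarrow> x \<in> carrier W \<Longrightarrow> g \<otimes>\<^bsub>W\<^esub> x \<otimes>\<^bsub>W\<^esub> \<psi> (inv\<^bsub>W\<^esub> g) \<in> carrier W"
  by (simp add: hom_in_carrier[OF \<psi>_hom])

lemma snd_twisted_conj:
  assumes g: "g \<in> carrier W" and "x \<in> carrier W"
  shows "snd (g \<otimes>\<^bsub>W\<^esub> x \<otimes>\<^bsub>W\<^esub> \<psi> (inv\<^bsub>W\<^esub> g)) = snd x + \<delta> (snd g)"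
  using snd_\<psi>[OF W.inv_closed[OF g]] snd_inv_wreath_Zk[OF G.is_group g]
    additive.minus[OF additive_phi_bar]
  by (simp add: mult_wreath_Zk \<delta>_def algebra_simps)

lemma twisted_conj_snd_diff:
  assumes "(x, y) \<in> twisted_conj W \<psi>"
  shows "snd y - snd x \<in> range \<delta>"
proof -
  obtain g where g: "g \<in> carrier W" and "x \<in> carrier W"
    and "y = g \<otimes>\<^bsub>W\<^esub> x \<otimes>\<^bsub>W\<^esub> \<psi> (inv\<^bsub>W\<^esub> g)"
    using assms unfolding twisted_conj_def by blast
  then have "snd y - snd x = \<delta> (snd g)"
    using snd_twisted_conj[OF g] by simp
  then show ?thesis by blast
qed

lemma inj_delta_if_finite_classes:
  assumes "finite (carrier W // twisted_conj W \<psi>)"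
  shows "inj \<delta>"
proof (rule additive_int_vector_inj[OF additive_delta])
  fix v :: "'n \<Rightarrow> int"
  define cls where "cls j = twisted_conj W \<psi> `` {zk_elt G (\<lambda>i. int j * v i)}" for j :: nat
  have "range cls \<subseteq> carrier W // twisted_conj W \<psi>"
    unfolding cls_def using zk_elt_closed[OF G.is_monoid] by (auto intro: quotientI)
  then have "\<not> inj cls"
    using assms finite_subset infinite_UNIV_nat finite_imageD by blast
  then obtain j\<^sub>1 j\<^sub>2 where "j\<^sub>1 < j\<^sub>2" and same_class: "cls j\<^sub>1 = cls j\<^sub>2"
    unfolding inj_def by (metis linorder_neq_iff)
  have "zk_elt G (\<lambda>i. int j\<^sub>2 * v i) \<in> cls j\<^sub>2"
    using twisted_conj_equiv[OF W.is_group \<psi>_hom] zk_elt_closed[OF G.is_monoid]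
    by (auto simp: cls_def equiv_def refl_on_def)
  then have "zk_elt G (\<lambda>i. int j\<^sub>2 * v i) \<in> cls j\<^sub>1"
    by (simp add: same_class)
  then have "(zk_elt G (\<lambda>i. int j\<^sub>1 * v i), zk_elt G (\<lambda>i. int j\<^sub>2 * v i)) \<in> twisted_conj W \<psi>"
    by (simp add: cls_def)
  then have "(\<lambda>i. int j\<^sub>2 * v i) - (\<lambda>i. int j\<^sub>1 * v i) \<in> range \<delta>"
    using twisted_conj_snd_diff by (metis zk_elt_eq snd_conv)
  moreover have "(\<lambda>i. int j\<^sub>2 * v i) - (\<lambda>i. int j\<^sub>1 * v i) = (\<lambda>i. (int j\<^sub>2 - int j\<^sub>1) * v i)"
    by (simp add: fun_eq_iff algebra_simps)
  ultimately obtain w where "\<delta> w = (\<lambda>i. (int j\<^sub>2 - int j\<^sub>1) * v i)"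
    by auto
  then show "\<exists>j>0. \<exists>w. \<delta> w = (\<lambda>i. j * v i)"
    using \<open>j\<^sub>1 < j\<^sub>2\<close> by (intro exI[of _ "int j\<^sub>2 - int j\<^sub>1"]) auto
qed

lemma twisted_conj_meets_transversal:
  assumes x: "x \<in> carrier W"
  shows "\<exists>t\<in>transversal. (x, t) \<in> twisted_conj W \<psi>"
proof -
  obtain u where u: "coset_rep (snd x) - snd x = \<delta> u"
    using coset_rep_diff by blast
  define t where "t = zk_elt G u \<otimes>\<^bsub>W\<^esub> x \<otimes>\<^bsub>W\<^esub> \<psi> (inv\<^bsub>W\<^esub> zk_elt G u)"
  have t_closed: "t \<in> carrier W"
    unfolding t_def by (rule twisted_conj_closed[OF zk_elt_closed[OF G.is_monoid] x])
  have "snd t = coset_rep (snd x)"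
    using snd_twisted_conj[OF zk_elt_closed[OF G.is_monoid] x] u
    by (simp add: t_def zk_elt_eq algebra_simps)
  then have "t \<in> transversal"
    using t_closed coset_rep_eq[OF coset_rep_diff] by (simp add: transversal_def)
  moreover have "(x, t) \<in> twisted_conj W \<psi>"
    using x t_closed zk_elt_closed[OF G.is_monoid] unfolding twisted_conj_def t_def by blast
  ultimately show ?thesis by blast
qed

lemma twisted_conj_on_transversal:
  assumes "inj \<delta>" and x: "x \<in> transversal" and y: "y \<in> transversal"
  shows "(x, y) \<in> twisted_conj W \<psi> \<longleftrightarrow>
    (\<exists>g\<in>carrier W. snd g = 0 \<and> y = g \<otimes>\<^bsub>W\<^esub> x \<otimes>\<^bsub>W\<^esub> \<psi> (inv\<^bsub>W\<^esub> g))"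
proof
  assume "(x, y) \<in> twisted_conj W \<psi>"
  then obtain g where g: "g \<in> carrier W" and y_eq: "y = g \<otimes>\<^bsub>W\<^esub> x \<otimes>\<^bsub>W\<^esub> \<psi> (inv\<^bsub>W\<^esub> g)"
    unfolding twisted_conj_def by blast
  have snd_y: "snd y = snd x + \<delta> (snd g)"
    using snd_twisted_conj[OF g] x y_eq by (simp add: transversal_def)
  then have "coset_rep (snd y) = coset_rep (snd x)"
    by (intro coset_rep_eq) simp
  then have "snd y = snd x"
    using x y by (simp add: transversal_def)
  then have "\<delta> (snd g) = \<delta> 0"
    using snd_y additive.zero[OF additive_delta] by simp
  then have "snd g = 0"
    using \<open>inj \<delta>\<close> by (simp add: inj_eq)
  then show "\<exists>g\<in>carrier W. snd g = 0 \<and> y = g \<otimes>\<^bsub>W\<^esub> x \<otimes>\<^bsub>W\<^esub> \<psi> (inv\<^bsub>W\<^esub> g)"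
    using g y_eq by blast
next
  assume "\<exists>g\<in>carrier W. snd g = 0 \<and> y = g \<otimes>\<^bsub>W\<^esub> x \<otimes>\<^bsub>W\<^esub> \<psi> (inv\<^bsub>W\<^esub> g)"
  then show "(x, y) \<in> twisted_conj W \<psi>"
    using x y transversal_subset unfolding twisted_conj_def by blast
qed

end

context wreath_Zk_automorphism
begin

lemma reidemeister_phi_one: "reidemeister W \<phi> = reidemeister W (phi_one G \<phi>)"
proof (cases "finite (carrier W // twisted_conj W \<phi>) \<or> finite (carrier W // twisted_conj W (phi_one G \<phi>))")
  case True
  interpret lift: wreath_Zk_lift G \<phi> \<phi>
    by unfold_locales (simp_all add: \<phi>.homh snd_phi)
  interpret lift\<^sub>1: wreath_Zk_lift G \<phi> "phi_one G \<phi>"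
    by unfold_locales (simp_all add: phi_one_hom snd_phi_one)
  have "inj \<delta>"
    using True lift.inj_delta_if_finite_classes lift\<^sub>1.inj_delta_if_finite_classes by blast
  have agree: "phi_one G \<phi> (inv\<^bsub>W\<^esub> g) = \<phi> (inv\<^bsub>W\<^esub> g)" if "g \<in> carrier W" and "snd g = 0" for g
    using phi_one_eq_phi[OF W.inv_closed[OF that(1)]] snd_inv_wreath_Zk[OF G.is_group that(1)] that(2)
    by simp
  have "(x, y) \<in> twisted_conj W \<phi> \<longleftrightarrow> (x, y) \<in> twisted_conj W (phi_one G \<phi>)"
    if "x \<in> transversal" and "y \<in> transversal" for x y
    unfolding lift.twisted_conj_on_transversal[OF \<open>inj \<delta>\<close> that]
      lift\<^sub>1.twisted_conj_on_transversal[OF \<open>inj \<delta>\<close> that]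
    by (intro bex_cong conj_cong refl) (simp add: agree del: \<phi>.hom_inv)
  then have "twisted_conj W \<phi> \<inter> transversal \<times> transversal
      = twisted_conj W (phi_one G \<phi>) \<inter> transversal \<times> transversal"
    by blast
  with lift.twisted_conj_meets_transversal lift\<^sub>1.twisted_conj_meets_transversal show ?thesis
    by (intro reidemeister_eq_if_agree_on_transversal[OF W.is_group \<phi>.homh phi_one_hom
          transversal_subset])
next
  case False
  then show ?thesis by (simp add: reidemeister_def)
qed

end

theorem mainTheorem4:
  fixes G :: "('g, 'b) monoid_scheme"
    and \<phi> :: "((('n::finite) \<Rightarrow> int) \<Rightarrow> 'g) \<times> ('n \<Rightarrow> int) \<Rightarrow> (('n \<Rightarrow> int) \<Rightarrow> 'g) \<times> ('n \<Rightarrow> int)"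
  assumes "comm_group G" and "finite (carrier G)"
    and "\<phi> \<in> iso (wreath_Zk G) (wreath_Zk G)"
  shows "phi_one G \<phi> \<in> iso (wreath_Zk G) (wreath_Zk G)
    \<and> reidemeister (wreath_Zk G) \<phi> = reidemeister (wreath_Zk G) (phi_one G \<phi>)"
proof -
  interpret wreath_Zk_automorphism G \<phi>
    using assms by (simp add: wreath_Zk_automorphism_def wreath_Zk_automorphism_axioms_def)
  show ?thesis
    using phi_one_iso reidemeister_phi_one by blast
qed

end
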